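(* Let $p\ge1$. For every $t\ge0$ let $0<m_t\le L_t$, $\sigma_t\ge0$, $c_t\ge0$, $0\le\delta_t\le\frac{m_t}{L_t}$ with $\delta_t<1$, $0\le\alpha_t\le\frac{2(m_t-\delta_tL_t)}{L_t^2(1-\delta_t^2)}$, and let $F_t:\mathbb R^p\to\mathbb R^p$ be $m_t$-strongly monotone and $L_t$-Lipschitz, with $x_t^*$ the point satisfying $F_t(x_t^* )=0$. Consider the iteration $x_{t+1}=x_t-\alpha_t(F_t(x_t)+v_t)$ and assume, for all $t$, $\|v_t\|^2\le\delta_t^2\|F_t(x_t)\|^2+c_t^2$ and $\|x_{t+1}^*-x_t^*\|\le\sigma_t$. Let $\mathcal T_t\subseteq\mathbb R_+^5$ be the set of tuples of non-negative scalars $(\rho_t,\lambda_t^{(1)},\lambda_t^{(2)},\lambda_t^{(3)},\lambda_t^{(4)})$ satisfying $$\begin{bmatrix}1-\rho_t^2+\lambda_t^{(4)}L_t^2-2\lambda_t^{(1)}m_t&\lambda_t^{(1)}-\alpha_t&1&-\alpha_t\\ \lambda_t^{(1)}-\alpha_t&\alpha_t^2-\lambda_t^{(4)}+\delta_t^2\lambda_t^{(3)}&-\alpha_t&\alpha_t^2\\1&-\alpha_t&1-\lambda_t^{(2)}&-\alpha_t\\-\alpha_t&\alpha_t^2&-\alpha_t&\alpha_t^2-\lambda_t^{(3)}\end{bmatrix}\preceq0.$$ Let $\hat U_0=\|x_0-x_0^*\|^2$ and, for $t\ge0$, $$\hat U_{t+1}=\inf_{(\rho_t,\lambda_t^{(1)},\ldots,\lambda_t^{(4)})\in\mathcal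 T_t}\left(\rho_t^2\hat U_t+\lambda_t^{(2)}\sigma_t^2+\lambda_t^{(3)}c_t^2\right).$$ Then for all $t\ge0$, $$\hat U_{t+1}=\left(\sqrt{(1-2m_t\alpha_t+\alpha_t^2L_t^2)\hat U_t}+\alpha_t\sqrt{c_t^2+\delta_t^2L_t^2\hat U_t}+\sigma_t\right)^2.$$
   Context: $F_t$ is $m_t$-strongly monotone if $(F_t(x)-F_t(\tilde x))^T(x-\tilde x)\ge m_t\|x-\tilde x\|^2$ for all $x,\tilde x\in\mathbb R^p$, and $L_t$-Lipschitz if $\|F_t(x)-F_t(\tilde x)\|\le L_t\|x-\tilde x\|$ for all $x,\tilde x$. $P\preceq0$ means the symmetric matrix $P$ is negative semidefinite; norms are Euclidean. *)

theory Defs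
  imports "HOL-Analysis.Analysis"
begin

definition strongly_monotone :: "real \<Rightarrow> ('a::real_inner \<Rightarrow> 'a) \<Rightarrow> bool" where
  "strongly_monotone m F \<longleftrightarrow> (\<forall>x y. (F x - F y) \<bullet> (x - y) \<ge> m * (norm (x - y))\<^sup>2)"

definition neg_semidef :: "real^'n^'n \<Rightarrow> bool" where
  "neg_semidef P \<longleftrightarrow> transpose P = P \<and> (\<forall>z. z \<bullet> (P *v z) \<le> 0)"

lemma vector_4 [simp]:
  "(vector [a, b, c, d] :: 'a::zero^4) $ 1 = a"
  "(vector [a, b, c, d] :: 'a::zero^4) $ 2 = b"
  "(vector [a, b, c, d] :: 'a::zero^4) $ 3 = c"
  "(vector [a, b, c, d] :: 'a::zero^4) $ 4 = d"
  unfolding vector_def by simp_all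

definition lmi_matrix ::
  "real \<Rightarrow> real \<Rightarrow> real \<Rightarrow> real \<Rightarrow> real \<Rightarrow> real \<Rightarrow> real \<Rightarrow> real \<Rightarrow> real \<Rightarrow> real^4^4" where
  "lmi_matrix m L \<delta> \<alpha> \<rho> l1 l2 l3 l4 = vector
    [vector [1 - \<rho>\<^sup>2 + l4 * L\<^sup>2 - 2 * l1 * m, l1 - \<alpha>, 1, - \<alpha>],
     vector [l1 - \<alpha>, \<alpha>\<^sup>2 - l4 + \<delta>\<^sup>2 * l3, - \<alpha>, \<alpha>\<^sup>2],
     vector [1, - \<alpha>, 1 - l2, - \<alpha>],
     vector [- \<alpha>, \<alpha>\<^sup>2, - \<alpha>, \<alpha>\<^sup>2 - l3]]"

definition lmi_feasible ::
  "real \<Rightarrow> real \<Rightarrow> real \<Rightarrow> real \<Rightarrow> (real \<times> real \<times> real \<times> real \<times> real) set" where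
  "lmi_feasible m L \<delta> \<alpha> = {(\<rho>, l1, l2, l3, l4).
     \<rho> \<ge> 0 \<and> l1 \<ge> 0 \<and> l2 \<ge> 0 \<and> l3 \<ge> 0 \<and> l4 \<ge> 0 \<and>
     neg_semidef (lmi_matrix m L \<delta> \<alpha> \<rho> l1 l2 l3 l4)}"

(* The values are extended reals so that the infimum is the usual one, with value
   \<infinity> on an empty feasible set, instead of the unspecified real Inf {}. *)
primrec Uhat ::
  "(nat \<Rightarrow> real) \<Rightarrow> (nat \<Rightarrow> real) \<Rightarrow> (nat \<Rightarrow> real) \<Rightarrow> (nat \<Rightarrow> real) \<Rightarrow> (nat \<Rightarrow> real) \<Rightarrow>
   (nat \<Rightarrow> real) \<Rightarrow> real \<Rightarrow> nat \<Rightarrow> ereal" where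
  "Uhat m L \<delta> \<alpha> \<sigma> c U0 0 = ereal U0"
| "Uhat m L \<delta> \<alpha> \<sigma> c U0 (Suc t) =
     (INF (\<rho>, l1, l2, l3, l4) \<in> lmi_feasible (m t) (L t) (\<delta> t) (\<alpha> t).
        ereal (\<rho>\<^sup>2) * Uhat m L \<delta> \<alpha> \<sigma> c U0 t + ereal (l2 * (\<sigma> t)\<^sup>2 + l3 * (c t)\<^sup>2))"

end

theory Submission
  imports Defs
begin

text \<open>
  The matrix encodes the quadratic form
  \<open>(\<xi> - \<alpha> \<phi> + s - \<alpha> w)\<^sup>2 - \<rho>\<^sup>2 \<xi>\<^sup>2 - l2 s\<^sup>2 + 2 l1 (\<xi> \<phi> - m \<xi>\<^sup>2) + l4 (L\<^sup>2 \<xi>\<^sup>2 - \<phi>\<^sup>2) + l3 (\<delta>\<^sup>2 \<phi>\<^sup>2 - w\<^sup>2)\<close>.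
  Summing over the coordinates of plane vectors with \<open>\<xi> \<bullet> \<phi> = m \<bar>\<xi>\<bar>\<^sup>2\<close>, \<open>\<bar>\<phi>\<bar> = L \<bar>\<xi>\<bar>\<close>,
  \<open>\<bar>w\<bar>\<^sup>2 = \<delta>\<^sup>2 \<bar>\<phi>\<bar>\<^sup>2 + c\<^sup>2\<close> and with \<open>s\<close>, \<open>-w\<close> parallel to \<open>\<xi> - \<alpha> \<phi>\<close> bounds the infimum from below.
  From above, splitting the first square by the weighted inequality
  \<open>(a + b + c)\<^sup>2 \<le> a\<^sup>2/p + b\<^sup>2/q + c\<^sup>2/r\<close> with \<open>p + q + r = 1\<close> and matching coefficients gives a
  feasible tuple for all such weights; optimising the weights closes the gap.
\<close>

lemma lmi_quadratic_form:
  fixes z :: "real^4"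
  shows "z \<bullet> (lmi_matrix m L \<delta> \<alpha> \<rho> l1 l2 l3 l4 *v z) =
    (z$1 - \<alpha> * z$2 + z$3 - \<alpha> * z$4)\<^sup>2 - \<rho>\<^sup>2 * (z$1)\<^sup>2 - l2 * (z$3)\<^sup>2
    + 2 * l1 * (z$1 * z$2 - m * (z$1)\<^sup>2) + l4 * (L\<^sup>2 * (z$1)\<^sup>2 - (z$2)\<^sup>2)
    + l3 * (\<delta>\<^sup>2 * (z$2)\<^sup>2 - (z$4)\<^sup>2)"
  by (simp add: lmi_matrix_def inner_vec_def matrix_vector_mult_def sum_4)
    (simp add: algebra_simps power2_eq_square)

lemma transpose_lmi_matrix:
  "transpose (lmi_matrix m L \<delta> \<alpha> \<rho> l1 l2 l3 l4) = lmi_matrix m L \<delta> \<alpha> \<rho> l1 l2 l3 l4"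
  by (simp add: lmi_matrix_def transpose_def vec_eq_iff forall_4)

text \<open>The matrix is symmetric for all parameters, so only the sign of its quadratic form
  matters. Both bounds on the infimum use feasibility in this scalar form.\<close>

lemma neg_semidef_lmi_matrix_iff:
  "neg_semidef (lmi_matrix m L \<delta> \<alpha> \<rho> l1 l2 l3 l4) \<longleftrightarrow>
    (\<forall>\<xi> \<phi> s w. (\<xi> - \<alpha> * \<phi> + s - \<alpha> * w)\<^sup>2 + 2 * l1 * (\<xi> * \<phi> - m * \<xi>\<^sup>2)
      + l4 * (L\<^sup>2 * \<xi>\<^sup>2 - \<phi>\<^sup>2) + l3 * (\<delta>\<^sup>2 * \<phi>\<^sup>2 - w\<^sup>2) \<le> \<rho>\<^sup>2 * \<xi>\<^sup>2 + l2 * s\<^sup>2)"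
    (is "?N \<longleftrightarrow> (\<forall>\<xi> \<phi> s w. ?Q \<xi> \<phi> s w)")
proof
  assume N: ?N
  show "\<forall>\<xi> \<phi> s w. ?Q \<xi> \<phi> s w"
  proof (intro allI)
    fix \<xi> \<phi> s w
    have "vector [\<xi>, \<phi>, s, w] \<bullet> (lmi_matrix m L \<delta> \<alpha> \<rho> l1 l2 l3 l4 *v vector [\<xi>, \<phi>, s, w]) \<le> 0"
      using N by (simp add: neg_semidef_def)
    then show "?Q \<xi> \<phi> s w"
      unfolding lmi_quadratic_form by simp
  qed
next
  assume Q: "\<forall>\<xi> \<phi> s w. ?Q \<xi> \<phi> s w"
  have "z \<bullet> (lmi_matrix m L \<delta> \<alpha> \<rho> l1 l2 l3 l4 *v z) \<le> 0" for z
    unfolding lmi_quadratic_form using Q[rule_format, of "z$1" "z$2" "z$3" "z$4"] by linarith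
  then show ?N
    by (simp add: neg_semidef_def transpose_lmi_matrix)
qed

text \<open>Polar decomposition that also covers the zero vector, where any unit vector serves; this
  spares the lower bound a case split.\<close>

lemma exists_unit_parallel:
  fixes a b :: real
  shows "\<exists>d e. d\<^sup>2 + e\<^sup>2 = 1 \<and> a = sqrt (a\<^sup>2 + b\<^sup>2) * d \<and> b = sqrt (a\<^sup>2 + b\<^sup>2) * e"
proof (cases "a = 0 \<and> b = 0")
  case True
  moreover have "1\<^sup>2 + 0\<^sup>2 = (1::real)"
    by simp
  ultimately show ?thesis
    by (metis mult_zero_left power_zero_numeral add_0 real_sqrt_zero)
next
  case False
  define n where "n = sqrt (a\<^sup>2 + b\<^sup>2)"
  have n: "n \<noteq> 0" "n\<^sup>2 = a\<^sup>2 + b\<^sup>2"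
    using False unfolding n_def by (simp_all add: add_nonneg_eq_0_iff)
  have "(a / n)\<^sup>2 + (b / n)\<^sup>2 = 1"
    unfolding power_divide add_divide_distrib[symmetric] n(2)[symmetric] using n(1) by simp
  moreover have "a = n * (a / n)" "b = n * (b / n)"
    using n(1) by simp_all
  ultimately show ?thesis
    unfolding n_def by blast
qed

text \<open>Weak duality: a feasible tuple is tested on one planar configuration, chosen so that the
  factors of \<open>l1\<close> and \<open>l4\<close> vanish and the factor of \<open>l3\<close>
  becomes \<open>- c\<^sup>2\<close>.\<close>

lemma lmi_feasible_lower_bound:
  fixes m L \<delta> \<alpha> \<sigma> c u :: real
  assumes m: "0 < m" "m \<le> L" and u: "0 \<le> u"
    and feas: "(\<rho>, l1, l2, l3, l4) \<in> lmi_feasible m L \<delta> \<alpha>"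
  shows "(sqrt ((1 - 2 * m * \<alpha> + \<alpha>\<^sup>2 * L\<^sup>2) * u) + \<alpha> * sqrt (c\<^sup>2 + \<delta>\<^sup>2 * L\<^sup>2 * u) + \<sigma>)\<^sup>2
    \<le> \<rho>\<^sup>2 * u + (l2 * \<sigma>\<^sup>2 + l3 * c\<^sup>2)"
proof -
  \<comment> \<open>Since \<open>(m, k)\<close> has length \<open>L\<close>, the vector
    \<open>(f1, f2)\<close> makes both the strong monotonicity and the Lipschitz bound tight against
    \<open>(x1, 0)\<close>.\<close>
  define k where "k = sqrt (L\<^sup>2 - m\<^sup>2)"
  define W where "W = sqrt (c\<^sup>2 + \<delta>\<^sup>2 * L\<^sup>2 * u)"
  define R where "R = sqrt ((1 - 2 * m * \<alpha> + \<alpha>\<^sup>2 * L\<^sup>2) * u)"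
  define x1 where "x1 = sqrt u"
  define f1 where "f1 = m * sqrt u"
  define f2 where "f2 = k * sqrt u"
  have k2: "k\<^sup>2 = L\<^sup>2 - m\<^sup>2"
    unfolding k_def using m by (simp add: power_mono)
  have W2: "W\<^sup>2 = c\<^sup>2 + \<delta>\<^sup>2 * L\<^sup>2 * u"
    unfolding W_def using u by simp
  have x1: "x1\<^sup>2 = u" and xf: "x1 * f1 = m * u" and f: "f1\<^sup>2 + f2\<^sup>2 = L\<^sup>2 * u"
    unfolding x1_def f1_def f2_def using u
    by (simp_all add: power_mult_distrib k2 left_diff_distrib)
  have "(x1 - \<alpha> * f1)\<^sup>2 + (- \<alpha> * f2)\<^sup>2 = x1\<^sup>2 - 2 * \<alpha> * (x1 * f1) + \<alpha>\<^sup>2 * (f1\<^sup>2 + f2\<^sup>2)"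
    by (simp add: power2_eq_square algebra_simps)
  then have R: "sqrt ((x1 - \<alpha> * f1)\<^sup>2 + (- \<alpha> * f2)\<^sup>2) = R"
    unfolding R_def x1 xf f by (simp add: algebra_simps)
  obtain d e where de: "d\<^sup>2 + e\<^sup>2 = 1" "x1 - \<alpha> * f1 = R * d" "- \<alpha> * f2 = R * e"
    using exists_unit_parallel[of "x1 - \<alpha> * f1" "- \<alpha> * f2"] unfolding R by blast
  have Q: "(\<xi> - \<alpha> * \<phi> + s - \<alpha> * w)\<^sup>2 + 2 * l1 * (\<xi> * \<phi> - m * \<xi>\<^sup>2)
      + l4 * (L\<^sup>2 * \<xi>\<^sup>2 - \<phi>\<^sup>2) + l3 * (\<delta>\<^sup>2 * \<phi>\<^sup>2 - w\<^sup>2) \<le> \<rho>\<^sup>2 * \<xi>\<^sup>2 + l2 * s\<^sup>2" for \<xi> \<phi> s w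
    using feas unfolding lmi_feasible_def neg_semidef_lmi_matrix_iff by blast
  \<comment> \<open>Drift and error are both aligned with \<open>(d, e)\<close>, so the three
    contributions add without cancellation; \<open>S\<close> is the resulting coefficient of
    \<open>(d, e)\<close>.\<close>
  define S where "S = R + \<alpha> * W + \<sigma>"
  have S1: "x1 - \<alpha> * f1 + \<sigma> * d - \<alpha> * (- W * d) = S * d"
    unfolding S_def de(2) by (simp add: algebra_simps)
  have S2: "0 - \<alpha> * f2 + \<sigma> * e - \<alpha> * (- W * e) = S * e"
    unfolding S_def using de(3) by (simp add: algebra_simps)
  \<comment> \<open>The scalar inequality is instantiated once per coordinate and summed; the second
    instance has \<xi> = 0 because \<open>(x1, 0)\<close> lies on the first axis.\<close>
  have "(S * d)\<^sup>2 + (S * e)\<^sup>2 + 2 * l1 * (x1 * f1 - m * x1\<^sup>2) + l4 * (L\<^sup>2 * x1\<^sup>2 - (f1\<^sup>2 + f2\<^sup>2))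
      + l3 * (\<delta>\<^sup>2 * (f1\<^sup>2 + f2\<^sup>2) - W\<^sup>2 * (d\<^sup>2 + e\<^sup>2)) \<le> \<rho>\<^sup>2 * x1\<^sup>2 + l2 * \<sigma>\<^sup>2 * (d\<^sup>2 + e\<^sup>2)"
    using Q[of x1 f1 "\<sigma> * d" "- W * d"] Q[of 0 f2 "\<sigma> * e" "- W * e"] unfolding S1 S2
    by (simp add: algebra_simps power_mult_distrib)
  moreover have "(S * d)\<^sup>2 + (S * e)\<^sup>2 = S\<^sup>2"
    using de(1) by (simp add: power_mult_distrib flip: distrib_left)
  ultimately have "S\<^sup>2 \<le> \<rho>\<^sup>2 * u + (l2 * \<sigma>\<^sup>2 + l3 * c\<^sup>2)"
    unfolding x1 xf f de(1) W2 by (simp add: algebra_simps)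
  then show ?thesis
    unfolding S_def R_def W_def .
qed

text \<open>Cauchy-Schwarz in fractional form: the gap between the sides is a square over a positive
  denominator.\<close>

lemma sum_squared_le_weighted:
  fixes a b p q :: real
  assumes "0 < p" "0 < q"
  shows "(a + b)\<^sup>2 / (p + q) \<le> a\<^sup>2 / p + b\<^sup>2 / q"
proof -
  have "a\<^sup>2 / p + b\<^sup>2 / q - (a + b)\<^sup>2 / (p + q) = (a * q - b * p)\<^sup>2 / (p * q * (p + q))"
    using assms add_pos_pos[OF assms] by (simp add: divide_simps) (simp add: algebra_simps power2_eq_square)
  also have "\<dots> \<ge> 0"
    using assms by simp
  finally show ?thesis by simp
qed

lemma sum3_squared_le_weighted:
  fixes a b c p q r :: real
  assumes "0 < p" "0 < q" "0 < r" "p + q + r = 1"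
  shows "(a + b + c)\<^sup>2 \<le> a\<^sup>2 / p + b\<^sup>2 / q + c\<^sup>2 / r"
  using sum_squared_le_weighted[of p q a b] sum_squared_le_weighted[of "p + q" r "a + b" c] assms
  by simp

text \<open>Ideal weights are proportional to \<open>A\<close>, \<open>B\<close>, \<open>C\<close>,
  but some of these may be zero. The strict gap below \<open>y\<close> leaves room to enlarge each
  and keep all weights positive.\<close>

lemma weighted_squares_approx:
  fixes A B C y :: real
  assumes "0 \<le> A" "0 \<le> B" "0 \<le> C" and y: "(A + B + C)\<^sup>2 < y"
  shows "\<exists>p q r. 0 < p \<and> 0 < q \<and> 0 < r \<and> p + q + r = 1 \<and> A\<^sup>2 / p + B\<^sup>2 / q + C\<^sup>2 / r \<le> y"
proof -
  define T where "T = sqrt y"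
  \<comment> \<open>An equal share of the slack, so that the enlarged numbers sum to exactly
    \<open>T\<close> and dividing them by \<open>T\<close> gives weights of total 1.\<close>
  define e where "e = (T - (A + B + C)) / 3"
  have e: "0 < e"
    unfolding e_def T_def using real_less_rsqrt[OF y] by simp
  have T: "T = (A + e) + (B + e) + (C + e)"
    unfolding e_def by (simp add: field_simps)
  have T0: "0 < T"
    using T e assms(1-3) by linarith
  then have T2: "T\<^sup>2 = y"
    unfolding T_def by simp
  have term_le: "X\<^sup>2 / ((X + e) / T) \<le> T * (X + e)" if "0 \<le> X" for X
  proof -
    have "X\<^sup>2 \<le> (X + e)\<^sup>2"
      using that e by (intro power_mono) auto
    then show ?thesis
      using that e T0 by (simp add: field_simps power2_eq_square)
  qed
  have "A\<^sup>2 / ((A + e) / T) + B\<^sup>2 / ((B + e) / T) + C\<^sup>2 / ((C + e) / T)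
      \<le> T * (A + e) + T * (B + e) + T * (C + e)"
    by (intro add_mono term_le assms)
  also have "\<dots> = T * ((A + e) + (B + e) + (C + e))"
    by (simp only: distrib_left)
  also have "\<dots> = y"
    unfolding T[symmetric] using T2 by (simp add: power2_eq_square)
  finally have *: "A\<^sup>2 / ((A + e) / T) + B\<^sup>2 / ((B + e) / T) + C\<^sup>2 / ((C + e) / T) \<le> y" .
  have "(A + e) / T + (B + e) / T + (C + e) / T = 1"
    using T T0 by (simp flip: add_divide_distrib)
  moreover have "0 < (A + e) / T" "0 < (B + e) / T" "0 < (C + e) / T"
    using e T0 assms(1-3) by simp_all
  ultimately show ?thesis
    using * by blast
qed

text \<open>As \<open>m \<le> L\<close>, the expression dominates
  \<open>(1 - m * \<alpha>)\<^sup>2\<close>.\<close>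

lemma contraction_factor_nonneg:
  fixes m L \<alpha> :: real
  assumes "0 < m" "m \<le> L"
  shows "0 \<le> 1 - 2 * m * \<alpha> + \<alpha>\<^sup>2 * L\<^sup>2"
proof -
  have "\<alpha>\<^sup>2 * m\<^sup>2 \<le> \<alpha>\<^sup>2 * L\<^sup>2"
    using assms by (intro mult_left_mono power_mono) auto
  moreover have "0 \<le> (1 - m * \<alpha>)\<^sup>2" by simp
  ultimately show ?thesis
    by (simp add: power2_eq_square algebra_simps)
qed

text \<open>After the weighted split, \<open>l1\<close> cancels the mixed term in \<xi> and \<phi>,
  \<open>l3\<close> the square of \<open>w\<close>, \<open>l4\<close> the square of \<phi>, and
  \<open>l2\<close> matches the square of \<open>s\<close>. What remains is the coefficient of the
  square of \<xi>, which is taken as the square of \<rho>.\<close>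

lemma lmi_feasible_weights:
  fixes m L \<delta> \<alpha> p q r :: real
  assumes m: "0 < m" "m \<le> L" and \<alpha>: "0 \<le> \<alpha>"
    and pqr: "0 < p" "0 < q" "0 < r" "p + q + r = 1"
  shows "(sqrt ((1 - 2 * m * \<alpha> + \<alpha>\<^sup>2 * L\<^sup>2) / p + \<alpha>\<^sup>2 * \<delta>\<^sup>2 * L\<^sup>2 / q),
      \<alpha> / p, 1 / r, \<alpha>\<^sup>2 / q, \<alpha>\<^sup>2 / p + \<alpha>\<^sup>2 * \<delta>\<^sup>2 / q) \<in> lmi_feasible m L \<delta> \<alpha>"
proof -
  define g where "g = (1 - 2 * m * \<alpha> + \<alpha>\<^sup>2 * L\<^sup>2) / p + \<alpha>\<^sup>2 * \<delta>\<^sup>2 * L\<^sup>2 / q"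
  have g: "0 \<le> g"
    unfolding g_def using contraction_factor_nonneg[OF m] pqr by (intro add_nonneg_nonneg) simp_all
  have "(\<xi> - \<alpha> * \<phi> + s - \<alpha> * w)\<^sup>2 + 2 * (\<alpha> / p) * (\<xi> * \<phi> - m * \<xi>\<^sup>2)
      + (\<alpha>\<^sup>2 / p + \<alpha>\<^sup>2 * \<delta>\<^sup>2 / q) * (L\<^sup>2 * \<xi>\<^sup>2 - \<phi>\<^sup>2) + (\<alpha>\<^sup>2 / q) * (\<delta>\<^sup>2 * \<phi>\<^sup>2 - w\<^sup>2)
      \<le> (sqrt g)\<^sup>2 * \<xi>\<^sup>2 + (1 / r) * s\<^sup>2" for \<xi> \<phi> s w
  proof -
    have "(\<xi> - \<alpha> * \<phi> + s - \<alpha> * w)\<^sup>2 \<le> (\<xi> - \<alpha> * \<phi>)\<^sup>2 / p + (- \<alpha> * w)\<^sup>2 / q + s\<^sup>2 / r"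
      using sum3_squared_le_weighted[OF pqr, of "\<xi> - \<alpha> * \<phi>" "- \<alpha> * w" s] by (simp add: algebra_simps)
    moreover have "(\<xi> - \<alpha> * \<phi>)\<^sup>2 / p + (- \<alpha> * w)\<^sup>2 / q + s\<^sup>2 / r
        + 2 * (\<alpha> / p) * (\<xi> * \<phi> - m * \<xi>\<^sup>2)
        + (\<alpha>\<^sup>2 / p + \<alpha>\<^sup>2 * \<delta>\<^sup>2 / q) * (L\<^sup>2 * \<xi>\<^sup>2 - \<phi>\<^sup>2) + (\<alpha>\<^sup>2 / q) * (\<delta>\<^sup>2 * \<phi>\<^sup>2 - w\<^sup>2)
        = g * \<xi>\<^sup>2 + (1 / r) * s\<^sup>2"
      unfolding g_def divide_inverse by (simp add: algebra_simps power2_eq_square)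
    ultimately show ?thesis
      using g by simp
  qed
  then show ?thesis
    unfolding lmi_feasible_def neg_semidef_lmi_matrix_iff g_def[symmetric]
    using g \<alpha> pqr by simp
qed

lemma INF_lmi_feasible:
  fixes m L \<delta> \<alpha> \<sigma> c u :: real
  assumes m: "0 < m" "m \<le> L" and nn: "0 \<le> \<alpha>" "0 \<le> \<sigma>" "0 \<le> u"
  shows "(INF (\<rho>, l1, l2, l3, l4) \<in> lmi_feasible m L \<delta> \<alpha>.
      ereal (\<rho>\<^sup>2) * ereal u + ereal (l2 * \<sigma>\<^sup>2 + l3 * c\<^sup>2)) =
    ereal ((sqrt ((1 - 2 * m * \<alpha> + \<alpha>\<^sup>2 * L\<^sup>2) * u) + \<alpha> * sqrt (c\<^sup>2 + \<delta>\<^sup>2 * L\<^sup>2 * u) + \<sigma>)\<^sup>2)"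
    (is "?I = ereal ((?A + ?B + \<sigma>)\<^sup>2)")
proof (rule antisym)
  show "ereal ((?A + ?B + \<sigma>)\<^sup>2) \<le> ?I"
    using lmi_feasible_lower_bound[OF m nn(3)] by (auto intro!: INF_greatest)
  have gu: "0 \<le> (1 - 2 * m * \<alpha> + \<alpha>\<^sup>2 * L\<^sup>2) * u"
    using contraction_factor_nonneg[OF m] nn by simp
  have A2: "?A\<^sup>2 = (1 - 2 * m * \<alpha> + \<alpha>\<^sup>2 * L\<^sup>2) * u" and B2: "?B\<^sup>2 = \<alpha>\<^sup>2 * (c\<^sup>2 + \<delta>\<^sup>2 * L\<^sup>2 * u)"
    using gu nn by (simp_all add: power_mult_distrib)
  \<comment> \<open>The optimal weights can degenerate to zero, so the infimum is only compared with
    values strictly above the target.\<close>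
  have "?I \<le> ereal y" if y: "(?A + ?B + \<sigma>)\<^sup>2 < y" for y
  proof -
    obtain p q r where pqr: "0 < p" "0 < q" "0 < r" "p + q + r = 1"
      and le: "?A\<^sup>2 / p + ?B\<^sup>2 / q + \<sigma>\<^sup>2 / r \<le> y"
      using weighted_squares_approx[OF _ _ _ y] gu nn by auto
    define g where "g = (1 - 2 * m * \<alpha> + \<alpha>\<^sup>2 * L\<^sup>2) / p + \<alpha>\<^sup>2 * \<delta>\<^sup>2 * L\<^sup>2 / q"
    have g: "0 \<le> g"
      unfolding g_def using contraction_factor_nonneg[OF m] pqr by (intro add_nonneg_nonneg) simp_all
    have "?I \<le> ereal ((sqrt g)\<^sup>2) * ereal u + ereal ((1 / r) * \<sigma>\<^sup>2 + (\<alpha>\<^sup>2 / q) * c\<^sup>2)"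
      by (rule INF_lower2[OF lmi_feasible_weights[OF m nn(1) pqr]]) (simp add: g_def)
    \<comment> \<open>The part of \<open>g * u\<close> with denominator \<open>q\<close> joins the
      \<open>c\<^sup>2\<close> term to form \<open>?B\<^sup>2 / q\<close>.\<close>
    also have "\<dots> = ereal (?A\<^sup>2 / p + ?B\<^sup>2 / q + \<sigma>\<^sup>2 / r)"
      unfolding A2 B2 real_sqrt_pow2[OF g] unfolding g_def
      by (simp add: algebra_simps divide_inverse)
    also have "\<dots> \<le> ereal y"
      using le by simp
    finally show ?thesis .
  qed
  then have "?I \<le> y" if "ereal ((?A + ?B + \<sigma>)\<^sup>2) < y" for y
    using that by (cases y) auto
  then show "?I \<le> ereal ((?A + ?B + \<sigma>)\<^sup>2)"
    by (rule dense_ge)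
qed

theorem theorem3p6:
  fixes F :: "nat \<Rightarrow> real^'p \<Rightarrow> real^'p"
    and x xstar v :: "nat \<Rightarrow> real^'p"
    and m L \<sigma> c \<delta> \<alpha> :: "nat \<Rightarrow> real"
    and U :: "nat \<Rightarrow> ereal"
  assumes "\<And>t. 0 < m t" and "\<And>t. m t \<le> L t"
    and "\<And>t. 0 \<le> \<sigma> t" and "\<And>t. 0 \<le> c t"
    and "\<And>t. 0 \<le> \<delta> t" and "\<And>t. \<delta> t \<le> m t / L t" and "\<And>t. \<delta> t < 1"
    and "\<And>t. 0 \<le> \<alpha> t"
    and "\<And>t. \<alpha> t \<le> 2 * (m t - \<delta> t * L t) / ((L t)\<^sup>2 * (1 - (\<delta> t)\<^sup>2))"
    and "\<And>t. strongly_monotone (m t) (F t)"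
    and "\<And>t. (L t)-lipschitz_on UNIV (F t)"
    and "\<And>t. F t (xstar t) = 0"
    and "\<And>t. x (Suc t) = x t - \<alpha> t *\<^sub>R (F t (x t) + v t)"
    and "\<And>t. (norm (v t))\<^sup>2 \<le> (\<delta> t)\<^sup>2 * (norm (F t (x t)))\<^sup>2 + (c t)\<^sup>2"
    and "\<And>t. norm (xstar (Suc t) - xstar t) \<le> \<sigma> t"
  defines "U \<equiv> Uhat m L \<delta> \<alpha> \<sigma> c ((norm (x 0 - xstar 0))\<^sup>2)"
  shows "\<forall>t. U (Suc t) = ereal
    ((sqrt ((1 - 2 * m t * \<alpha> t + (\<alpha> t)\<^sup>2 * (L t)\<^sup>2) * real_of_ereal (U t))
      + \<alpha> t * sqrt ((c t)\<^sup>2 + (\<delta> t)\<^sup>2 * (L t)\<^sup>2 * real_of_ereal (U t))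
      + \<sigma> t)\<^sup>2)"
proof -
  note m = assms(1,2) and \<sigma> = assms(3) and \<alpha> = assms(8)
  \<comment> \<open>Every iterate is finite and non-negative, so \<open>real_of_ereal\<close> loses
    nothing and the one-step formula applies at each \<open>t\<close>.\<close>
  have real: "\<exists>u\<ge>0. U t = ereal u" for t
  proof (induction t)
    case 0
    show ?case by (simp add: U_def)
  next
    case (Suc t)
    then obtain u where u: "0 \<le> u" "U t = ereal u" by blast
    show ?case
      using INF_lmi_feasible[OF m \<alpha> \<sigma> u(1)] u(2) unfolding U_def by simp
  qed
  show ?thesis
  proof
    fix t
    obtain u where u: "0 \<le> u" "U t = ereal u"
      using real by blast
    show "U (Suc t) = ereal
      ((sqrt ((1 - 2 * m t * \<alpha> t + (\<alpha> t)\<^sup>2 * (L t)\<^sup>2) * real_of_ereal (U t))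
        + \<alpha> t * sqrt ((c t)\<^sup>2 + (\<delta> t)\<^sup>2 * (L t)\<^sup>2 * real_of_ereal (U t))
        + \<sigma> t)\<^sup>2)"
      using INF_lmi_feasible[OF m \<alpha> \<sigma> u(1)] u(2) unfolding U_def by simp
  qed
qed

end
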